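(* Let $(F_n)_{n\in\mathbb{Z}}$ be the Fibonacci numbers and let $(G_n)_{n\in\mathbb{Z}}$ be a Fibonacci-like sequence. Then for all integers $a$, $b$, $m$ and $n$, \[ F_{a-b}\,G_{n+m}=F_{m-b}\,G_{n+a}+(-1)^{a+b+1}F_{m-a}\,G_{n+b}. \]
   Context: The Fibonacci numbers are defined by $F_0=0$, $F_1=1$, $F_n=F_{n-1}+F_{n-2}$ for $n\ge 2$, and $F_{-n}=(-1)^{n-1}F_n$. A Fibonacci-like sequence $(G_n)_{n\in\mathbb{Z}}$ is defined by arbitrary integers $G_0,G_1$, not both zero, with $G_n=G_{n-1}+G_{n-2}$ for $n\ge 2$, extended to negative indices by $G_{-n}=G_{-n+2}-G_{-n+1}$ (so $G_n=G_{n-1}+G_{n-2}$ holds for all integers $n$). *)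

theory Defs
  imports "HOL-Number_Theory.Fib"
begin

text \<open>In the negative branch \<open>nat (- k)\<close> is at least 1, so the subtraction does not truncate.\<close>

definition fib_int :: "int \<Rightarrow> int" where
  "fib_int k =
     (if 0 \<le> k then int (fib (nat k)) else (-1) ^ (nat (- k) - 1) * int (fib (nat (- k))))"

definition fibonacci_like :: "(int \<Rightarrow> int) \<Rightarrow> bool" where
  "fibonacci_like G \<longleftrightarrow>
     \<not> (G 0 = 0 \<and> G 1 = 0) \<and>
     (\<forall>n\<ge>2. G n = G (n - 1) + G (n - 2)) \<and>
     (\<forall>n\<ge>1. G (- n) = G (- n + 2) - G (- n + 1))"

lemma fibonacci_like_iff:
  "fibonacci_like G \<longleftrightarrow>
     \<not> (G 0 = 0 \<and> G 1 = 0) \<and> (\<forall>n. G n = G (n - 1) + G (n - 2))"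
proof -
  have "G n = G (n - 1) + G (n - 2)"
    if pos: "\<forall>n\<ge>2. G n = G (n - 1) + G (n - 2)"
      and neg: "\<forall>n\<ge>1. G (- n) = G (- n + 2) - G (- n + 1)" for n
  proof (cases "2 \<le> n")
    case True
    then show ?thesis using pos by blast
  next
    case False
    then have "1 \<le> 2 - n" by simp
    with neg have "G (- (2 - n)) = G (- (2 - n) + 2) - G (- (2 - n) + 1)" by blast
    moreover have "- (2 - n) = n - 2" "- (2 - n) + 2 = n" "- (2 - n) + 1 = n - 1" by simp_all
    ultimately show ?thesis by simp
  qed
  moreover have "G (- n) = G (- n + 2) - G (- n + 1)"
    if rec: "\<forall>n. G n = G (n - 1) + G (n - 2)" for n
  proof -
    have "G (- n + 2) = G (- n + 2 - 1) + G (- n + 2 - 2)" using rec by blast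
    moreover have "- n + 2 - 1 = - n + 1" "- n + 2 - 2 = - n" by simp_all
    ultimately show ?thesis by simp
  qed
  ultimately show ?thesis unfolding fibonacci_like_def by blast
qed

end

(* Both sides satisfy the Fibonacci recurrence in m, so it suffices to compare them at the
   adjacent points m = a and m = a + 1. The first is trivial; the second is d'Ocagne's identity
   F_(k+1) G_(N+k) - F_k G_(N+k+1) = (-1)^k G_N with k = a - b and N = n + b, which holds because
   its left side changes sign when k is replaced by k + 1. *)

theory Submission
  imports Defs
begin

lemma fib_int_0 [simp]: "fib_int 0 = 0"
  by (simp add: fib_int_def)

lemma fib_int_1 [simp]: "fib_int 1 = 1"
  by (simp add: fib_int_def)

text \<open>For \<open>k \<ge> 2\<close> this is the recurrence of \<open>fib\<close>; at
  \<open>k = 1\<close> and \<open>k = 0\<close> the three indices straddle both branches of the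
  definition, so the values are computed. For \<open>k = - int j - 1\<close> the alternating signs
  turn it into F_(j+1) = F_(j+3) - F_(j+2).\<close>

lemma fib_int_rec: "fib_int k = fib_int (k - 1) + fib_int (k - 2)"
proof -
  consider j where "k = int j + 2" | "k = 1" | "k = 0" | j where "k = - int j - 1"
  proof (cases "k \<ge> 2")
    case True
    then have "k = int (nat (k - 2)) + 2" by simp
    then show ?thesis using that by blast
  next
    case False
    show ?thesis
    proof (cases "k < 0")
      case True
      then have "k = - int (nat (- k - 1)) - 1" by simp
      then show ?thesis using that by blast
    next
      case False
      with \<open>\<not> k \<ge> 2\<close> have "k = 0 \<or> k = 1" by linarith
      then show ?thesis using that by blast
    qed
  qed
  then show ?thesis
  proof cases
    case (1 j)
    have "nat (int j + 2) = Suc (Suc j)" "nat (1 + int j) = Suc j" by simp_all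
    then show ?thesis using 1 by (simp add: fib_int_def)
  next
    case (4 j)
    have "nat (1 + int j) = Suc j" "nat (int j + 2) = Suc (Suc j)"
      "nat (int j + 3) = Suc (Suc (Suc j))" by simp_all
    then show ?thesis unfolding 4 by (simp add: fib_int_def algebra_simps)
  qed (simp_all add: fib_int_def numeral_2_eq_2)
qed

lemma fibonacci_rec_eq_0:
  fixes H :: "int \<Rightarrow> 'a :: ab_group_add"
  assumes rec: "\<And>k. H k = H (k - 1) + H (k - 2)"
    and "H c = 0" "H (c + 1) = 0"
  shows "H k = 0"
proof -
  \<comment> \<open>A pair of adjacent zeros propagates in both directions, since the recurrence can
    also be solved for its last term.\<close>
  have "H k = 0 \<and> H (k + 1) = 0"
  proof (induction k rule: int_induct[where k = c])
    case base
    show ?case using assms(2,3) by simp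
  next
    case (step1 i)
    then show ?case using rec[of "i + 2"] by (simp add: add.commute)
  next
    case (step2 i)
    then show ?case using rec[of "i + 1"] by auto
  qed
  then show ?thesis ..
qed

text \<open>The cast into a field gives \<open>(-1) powi k\<close> a meaning for negative
  \<open>k\<close>.\<close>

lemma d_Ocagne:
  fixes G :: "int \<Rightarrow> int"
  assumes rec: "\<And>k. G k = G (k - 1) + G (k - 2)"
  shows "(of_int (fib_int (k + 1) * G (N + k) - fib_int k * G (N + k + 1)) :: 'a :: field) =
           (-1) powi k * of_int (G N)"
proof -
  define D where "D k = fib_int (k + 1) * G (N + k) - fib_int k * G (N + k + 1)" for k
  have D_step: "D (k + 1) = - D k" for k
  proof -
    have "fib_int (k + 2) = fib_int (k + 1) + fib_int k"
      using fib_int_rec[of "k + 2"] by (simp add: add.commute)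
    moreover have "G (N + k + 2) = G (N + k + 1) + G (N + k)"
      using rec[of "N + k + 2"] by (simp add: algebra_simps)
    ultimately show ?thesis unfolding D_def by (simp add: algebra_simps)
  qed
  have "(of_int (D k) :: 'a) = (-1) powi k * of_int (G N)"
  proof (induction k rule: int_induct[where k = 0])
    case base
    show ?case by (simp add: D_def)
  next
    case (step1 i)
    then show ?case by (simp add: D_step power_int_add)
  next
    case (step2 i)
    have "D (i - 1) = - D i" using D_step[of "i - 1"] by simp
    then show ?case using step2 by (simp add: power_int_diff)
  qed
  then show ?thesis by (simp only: D_def)
qed

theorem theorem1:
  fixes G :: "int \<Rightarrow> int" and a b m n :: int
  assumes "fibonacci_like G"
  shows "(of_int (fib_int (a - b) * G (n + m)) :: rat) =
           of_int (fib_int (m - b) * G (n + a)) +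
           (-1) powi (a + b + 1) * of_int (fib_int (m - a) * G (n + b))"
proof -
  have rec: "G k = G (k - 1) + G (k - 2)" for k
    using assms unfolding fibonacci_like_iff by blast
  define s :: rat where "s = (-1) powi (a + b + 1)"
  \<comment> \<open>The exponents \<open>a + b + 1\<close> and \<open>a - b\<close> differ by the
    odd number \<open>2 * b + 1\<close>.\<close>
  have s: "s = - ((-1) powi (a - b))"
    by (simp add: s_def power_int_add power_int_diff power_int_minus_left)
  define H where "H m = of_int (fib_int (a - b) * G (n + m)) -
    of_int (fib_int (m - b) * G (n + a)) - s * of_int (fib_int (m - a) * G (n + b))" for m
  have "H m = 0"
  proof (rule fibonacci_rec_eq_0[where c = a])
    show "H k = H (k - 1) + H (k - 2)" for k
    proof -
      have "fib_int (k - c) = fib_int (k - 1 - c) + fib_int (k - 2 - c)" for c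
        using fib_int_rec[of "k - c"] by (simp add: algebra_simps)
      from this[of a] this[of b]
      have "fib_int (k - a) = fib_int (k - 1 - a) + fib_int (k - 2 - a)"
        "fib_int (k - b) = fib_int (k - 1 - b) + fib_int (k - 2 - b)" .
      moreover have "G (n + k) = G (n + (k - 1)) + G (n + (k - 2))"
        using rec[of "n + k"] by (simp add: algebra_simps)
      ultimately show ?thesis unfolding H_def by (simp add: algebra_simps)
    qed
    show "H a = 0" by (simp add: H_def)
    \<comment> \<open>Here \<open>fib_int (m - a)\<close> is 1 and \<open>n + a\<close> is N + k, so
      \<open>H (a + 1)\<close> is -(-1)^k G_N - s G_N, which vanishes by the sign relation
      \<open>s\<close>.\<close>
    show "H (a + 1) = 0"
      using d_Ocagne[of G "a - b" "n + b", OF rec, where 'a = rat]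
      by (simp add: H_def s algebra_simps)
  qed
  then show ?thesis by (simp add: H_def s_def)
qed

end
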